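(* Let $V$ and $H$ be complex Hilbert spaces, let $\mathfrak{a} \colon V \times V \to \mathbb{C}$ be an accretive continuous sesquilinear form and let $j \in \mathcal{L}(V,H)$. Let $A$ be the graph associated with $(\mathfrak{a},j)$. If $\mathfrak{a}$ is compactly elliptic, then $A$ is $m$-accretive.
   Context: Sesquilinear forms are linear in the first and antilinear in the second variable, and $\mathfrak{a}(u) := \mathfrak{a}(u,u)$. $\mathcal{L}(X,Y)$ denotes the bounded linear operators from $X$ to $Y$. The form $\mathfrak{a}$ is accretive if $\mathrm{Re}\, \mathfrak{a}(u) \geq 0$ for all $u \in V$. The form $\mathfrak{a}$ is called compactly elliptic if there exist a Hilbert space $\widetilde{H}$, a compact $\tilde{j} \in \mathcal{L}(V,\widetilde{H})$, $\omega \in \mathbb{R}$ and $\mu > 0$ such that $\mathrm{Re}\, \mathfrak{a}(u) + \omega \|\tilde{j}(u)\|_{\widetilde{H}}^2 \geq \mu \|u\|_V^2$ for all $u \in V$. A graph in $H$ is a linear subspace of $H \times H$. The graph associated with $(\mathfrak{a},j)$ is $$A = \{(x,y) \in H \times H : \text{there exists } u \in V \text{ such that } j(u) = x \text{ and } \mathfrak{a}(u,v) = (y,j(v))_H \text{ for all } v \in V\}.$$ A graph $A$ is accretive if $\mathrm{Re}\,(x,y)_H \geq 0$ for all $(x,y) \in A$; it is $m$-accretive if it is accretive and $A + I = \{(x,y+x) : (x,y) \in A\}$ is surjective, i.e. $\{y + x : (x,y) \in A\} = H$. *)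

theory Defs
  imports "HOL-Analysis.Analysis"
begin

text \<open>
  Complex Hilbert spaces as a type class on top of the real normed spaces of the library.
  The inner product is linear in the first and antilinear in the second argument.
  The last axiom contains both positive definiteness and the fact that the norm
  (hence the topology) is the one induced by the inner product.
\<close>

class complex_inner = real_normed_vector +
  fixes scaleC :: "complex \<Rightarrow> 'a \<Rightarrow> 'a" (infixr "*\<^sub>C" 75)
    and cinner :: "'a \<Rightarrow> 'a \<Rightarrow> complex"
  assumes scaleC_add_right: "c *\<^sub>C (x + y) = c *\<^sub>C x + c *\<^sub>C y"
    and scaleC_add_left: "(c + d) *\<^sub>C x = c *\<^sub>C x + d *\<^sub>C x"
    and scaleC_scaleC: "c *\<^sub>C (d *\<^sub>C x) = (c * d) *\<^sub>C x"
    and scaleC_of_real: "complex_of_real r *\<^sub>C x = r *\<^sub>R x"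
    and cinner_add_left: "cinner (x + y) z = cinner x z + cinner y z"
    and cinner_scaleC_left: "cinner (c *\<^sub>C x) y = c * cinner x y"
    and cinner_commute: "cinner y x = cnj (cinner x y)"
    and cinner_same: "cinner x x = complex_of_real ((norm x)\<^sup>2)"

class chilbert_space = complex_inner + banach

instantiation complex :: chilbert_space
begin

definition scaleC_complex :: "complex \<Rightarrow> complex \<Rightarrow> complex" where
  "scaleC_complex c x = c * x"

definition cinner_complex :: "complex \<Rightarrow> complex \<Rightarrow> complex" where
  "cinner_complex x y = x * cnj y"

instance
  by standard
    (simp_all add: scaleC_complex_def cinner_complex_def algebra_simps scaleR_conv_of_real
       complex_norm_square[symmetric])

end

definition bounded_clinear :: "('a::complex_inner \<Rightarrow> 'b::complex_inner) \<Rightarrow> bool" where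
  "bounded_clinear T \<longleftrightarrow> bounded_linear T \<and> (\<forall>c x. T (c *\<^sub>C x) = c *\<^sub>C T x)"

definition compact_operator :: "('a::complex_inner \<Rightarrow> 'b::complex_inner) \<Rightarrow> bool" where
  "compact_operator T \<longleftrightarrow> bounded_clinear T \<and> (\<forall>S. bounded S \<longrightarrow> compact (closure (T ` S)))"

definition sesquilinear :: "('a::complex_inner \<Rightarrow> 'a \<Rightarrow> complex) \<Rightarrow> bool" where
  "sesquilinear a \<longleftrightarrow>
    (\<forall>u v w. a (u + v) w = a u w + a v w) \<and>
    (\<forall>u v w. a u (v + w) = a u v + a u w) \<and>
    (\<forall>c u v. a (c *\<^sub>C u) v = c * a u v) \<and>
    (\<forall>c u v. a u (c *\<^sub>C v) = cnj c * a u v)"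

definition continuous_form :: "('a::complex_inner \<Rightarrow> 'a \<Rightarrow> complex) \<Rightarrow> bool" where
  "continuous_form a \<longleftrightarrow> continuous_on UNIV (\<lambda>(u, v). a u v)"

definition accretive_form :: "('a::complex_inner \<Rightarrow> 'a \<Rightarrow> complex) \<Rightarrow> bool" where
  "accretive_form a \<longleftrightarrow> (\<forall>u. Re (a u u) \<ge> 0)"

text \<open>
  HOL cannot quantify existentially over the auxiliary Hilbert space inside a formula, so it
  is a type parameter. In a hypothesis of a theorem, a type variable in this place is
  universally quantified over the whole theorem, which amounts to the existential
  quantification over the Hilbert space in the hypothesis.
\<close>

definition compactly_elliptic ::
    "'k::chilbert_space itself \<Rightarrow> ('v::chilbert_space \<Rightarrow> 'v \<Rightarrow> complex) \<Rightarrow> bool" where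
  "compactly_elliptic K a \<longleftrightarrow>
    (\<exists>(j' :: 'v \<Rightarrow> 'k) (\<omega>::real) (\<mu>::real). compact_operator j' \<and> \<mu> > 0 \<and>
      (\<forall>u. Re (a u u) + \<omega> * (norm (j' u))\<^sup>2 \<ge> \<mu> * (norm u)\<^sup>2))"

text \<open>A graph in \<open>H\<close> is a complex linear subspace of \<open>H \<times> H\<close>.\<close>

definition linear_graph :: "('h::complex_inner \<times> 'h) set \<Rightarrow> bool" where
  "linear_graph A \<longleftrightarrow> (0, 0) \<in> A \<and>
    (\<forall>x y x' y'. (x, y) \<in> A \<longrightarrow> (x', y') \<in> A \<longrightarrow> (x + x', y + y') \<in> A) \<and>
    (\<forall>c x y. (x, y) \<in> A \<longrightarrow> (c *\<^sub>C x, c *\<^sub>C y) \<in> A)"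

definition accretive_graph :: "('h::complex_inner \<times> 'h) set \<Rightarrow> bool" where
  "accretive_graph A \<longleftrightarrow> linear_graph A \<and> (\<forall>(x, y) \<in> A. Re (cinner x y) \<ge> 0)"

definition m_accretive :: "('h::complex_inner \<times> 'h) set \<Rightarrow> bool" where
  "m_accretive A \<longleftrightarrow> accretive_graph A \<and> {y + x | x y. (x, y) \<in> A} = UNIV"

definition associated_graph ::
    "('v::complex_inner \<Rightarrow> 'v \<Rightarrow> complex) \<Rightarrow> ('v \<Rightarrow> 'h::complex_inner) \<Rightarrow> ('h \<times> 'h) set" where
  "associated_graph a j = {(x, y). \<exists>u. j u = x \<and> (\<forall>v. a u v = cinner y (j v))}"

end

theory Submission
  imports Defs
begin

text \<open>
  Accretivity of the graph is immediate: if \<open>j u = x\<close> and \<open>a(u, v) = (y, j v)\<close> for all \<open>v\<close>, then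
  \<open>(y, x) = a(u, u)\<close>. For surjectivity of \<open>A + I\<close> one has to find, given \<open>f\<close>, some \<open>u\<close> with
  \<open>b(u, v) = (f, j v)\<close> for all \<open>v\<close>, where \<open>b(u, v) = a(u, v) + (j u, j v)\<close>; then \<open>(j u, f - j u)\<close>
  lies in the graph. The form \<open>b\<close> is again accretive and compactly elliptic, but it may have a
  nonzero kernel \<open>{w. b(w, \<cdot>) = 0}\<close>, so it is not coercive in general. However, \<open>w\<close> in the kernel gives
  \<open>0 = Re b(w, w) \<ge> \<parallel>j w\<parallel>\<^sup>2\<close>, so the functional \<open>(f, j \<cdot>)\<close> vanishes on the kernel of \<open>b\<close>. The theorem
  is therefore a case of a Fredholm alternative for accretive compactly elliptic forms
  (\<open>accretive_compactly_elliptic_solvable\<close>): \<open>b(u, \<cdot>) = \<phi>\<close> is solvable as soon as \<open>\<phi>\<close> vanishes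
  on the kernel of \<open>b\<close>.

  The alternative is proved by regularisation. The form \<open>b + \<epsilon>(\<cdot>, \<cdot>)\<close> is coercive, so the Lax-Milgram
  lemma yields \<open>u\<^sub>\<epsilon>\<close> with \<open>b(u\<^sub>\<epsilon>, \<cdot>) + \<epsilon>(u\<^sub>\<epsilon>, \<cdot>) = \<phi>\<close>. Ellipticity up to a compact term makes
  bounded sequences of approximate solutions strongly precompact, with exact solutions as limits
  (\<open>compactly_elliptic_approximate_solutions\<close>). Hence it suffices that the \<open>u\<^sub>\<epsilon>\<close> do not blow up
  as \<open>\<epsilon> \<rightarrow> 0\<close>. If they did, the normalised \<open>u\<^sub>\<epsilon>\<close> would accumulate at a unit vector \<open>w\<close> in
  the kernel of \<open>b\<close>. By accretivity \<open>w\<close> also satisfies \<open>b(\<cdot>, w) = 0\<close>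
  (\<open>accretive_form_kernel_symmetric\<close>), so testing the regularised equation with \<open>w\<close> gives
  \<open>\<epsilon>(u\<^sub>\<epsilon>, w) = \<phi>(w) = 0\<close>. But vectors orthogonal to \<open>w\<close> cannot accumulate at \<open>w\<close>.
\<close>

section \<open>Bounded sesquilinear forms\<close>

definition bounded_antilinear :: "('a::complex_inner \<Rightarrow> complex) \<Rightarrow> bool" where
  "bounded_antilinear \<phi> \<longleftrightarrow>
    (\<forall>x y. \<phi> (x + y) = \<phi> x + \<phi> y) \<and>
    (\<forall>c x. \<phi> (c *\<^sub>C x) = cnj c * \<phi> x) \<and>
    (\<exists>C. \<forall>x. norm (\<phi> x) \<le> C * norm x)"

definition bounded_form :: "('a::complex_inner \<Rightarrow> 'a \<Rightarrow> complex) \<Rightarrow> bool" where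
  "bounded_form b \<longleftrightarrow> sesquilinear b \<and> (\<exists>M. \<forall>u v. norm (b u v) \<le> M * norm u * norm v)"

lemma bounded_antilinear_add: "bounded_antilinear \<phi> \<Longrightarrow> \<phi> (x + y) = \<phi> x + \<phi> y"
  and bounded_antilinear_scaleC: "bounded_antilinear \<phi> \<Longrightarrow> \<phi> (c *\<^sub>C x) = cnj c * \<phi> x"
  by (auto simp: bounded_antilinear_def)

lemma bounded_antilinear_scaleR:
  "bounded_antilinear \<phi> \<Longrightarrow> \<phi> (r *\<^sub>R x) = complex_of_real r * \<phi> x"
  using bounded_antilinear_scaleC[of \<phi> "complex_of_real r" x] by (simp add: scaleC_of_real)

lemma pos_bound:
  fixes f :: "'b \<Rightarrow> real"
  assumes "\<exists>C. \<forall>x. f x \<le> C * g x" and "\<And>x. 0 \<le> g x"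
  obtains C where "C > 0" and "\<And>x. f x \<le> C * g x"
proof -
  from assms(1) obtain C where C: "\<And>x. f x \<le> C * g x" by blast
  have "f x \<le> (\<bar>C\<bar> + 1) * g x" for x
    using C[of x] mult_right_mono[OF _ assms(2), of C "\<bar>C\<bar> + 1" x] by linarith
  then show thesis by (intro that[of "\<bar>C\<bar> + 1"]) auto
qed

lemma bounded_antilinear_pos_bound:
  assumes "bounded_antilinear \<phi>"
  obtains C where "C > 0" and "\<And>x. norm (\<phi> x) \<le> C * norm x"
  using pos_bound[of "\<lambda>x. norm (\<phi> x)" norm] assms unfolding bounded_antilinear_def by auto

lemma bounded_form_pos_bound:
  assumes "bounded_form b"
  obtains M where "M > 0" and "\<And>u v. norm (b u v) \<le> M * norm u * norm v"
proof -
  have "\<exists>M. \<forall>p. norm (case p of (u, v) \<Rightarrow> b u v) \<le> M * (case p of (u, v) \<Rightarrow> norm u * norm v)"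
    using assms by (auto simp: bounded_form_def mult.assoc)
  then obtain M where "M > 0"
    and M: "\<And>p. norm (case p of (u, v) \<Rightarrow> b u v) \<le> M * (case p of (u, v) \<Rightarrow> norm u * norm v)"
    by (rule pos_bound) auto
  have "norm (b u v) \<le> M * norm u * norm v" for u v
    using M[of "(u, v)"] by (simp add: mult.assoc)
  with \<open>M > 0\<close> show thesis by (rule that)
qed

lemma sesquilinear_add_left: "sesquilinear b \<Longrightarrow> b (u + v) w = b u w + b v w"
  and sesquilinear_add_right: "sesquilinear b \<Longrightarrow> b u (v + w) = b u v + b u w"
  and sesquilinear_scaleC_left: "sesquilinear b \<Longrightarrow> b (c *\<^sub>C u) v = c * b u v"
  and sesquilinear_scaleC_right: "sesquilinear b \<Longrightarrow> b u (c *\<^sub>C v) = cnj c * b u v"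
  by (simp_all add: sesquilinear_def)

lemma sesquilinear_scaleR_left: "sesquilinear b \<Longrightarrow> b (r *\<^sub>R u) v = complex_of_real r * b u v"
  and sesquilinear_scaleR_right: "sesquilinear b \<Longrightarrow> b u (r *\<^sub>R v) = complex_of_real r * b u v"
  using sesquilinear_scaleC_left[of b "complex_of_real r" u v]
    sesquilinear_scaleC_right[of b u "complex_of_real r" v]
  by (simp_all add: scaleC_of_real)

lemma sesquilinear_diff_left: "sesquilinear b \<Longrightarrow> b (u - v) w = b u w - b v w"
  using sesquilinear_add_left[of b "u - v" v w] by (simp add: algebra_simps)

lemma bounded_form_antilinear:
  assumes "bounded_form b"
  shows "bounded_antilinear (b u)"
  using assms unfolding bounded_form_def bounded_antilinear_def sesquilinear_def by blast

lemma sesquilinear_cinner: "sesquilinear (cinner :: 'a::complex_inner \<Rightarrow> 'a \<Rightarrow> complex)"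
proof -
  have "cinner u (v + w) = cinner u v + cinner u w" for u v w :: 'a
    by (metis cinner_add_left cinner_commute complex_cnj_add)
  moreover have "cinner u (c *\<^sub>C v) = cnj c * cinner u v" for c and u v :: 'a
    by (metis cinner_scaleC_left cinner_commute complex_cnj_mult)
  ultimately show ?thesis
    by (simp add: sesquilinear_def cinner_add_left cinner_scaleC_left)
qed

lemmas cinner_diff_left = sesquilinear_diff_left[OF sesquilinear_cinner]
lemmas cinner_scaleR_left = sesquilinear_scaleR_left[OF sesquilinear_cinner]
lemmas cinner_add_right = sesquilinear_add_right[OF sesquilinear_cinner]
lemmas cinner_scaleR_right = sesquilinear_scaleR_right[OF sesquilinear_cinner]
lemmas cinner_scaleC_right = sesquilinear_scaleC_right[OF sesquilinear_cinner]

lemma power2_norm_add_cinner: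
  "(norm (x + y))\<^sup>2 = (norm x)\<^sup>2 + 2 * Re (cinner x y) + (norm (y::'a::complex_inner))\<^sup>2"
proof -
  have "complex_of_real ((norm (x + y))\<^sup>2) = cinner x x + (cinner x y + cnj (cinner x y)) + cinner y y"
    unfolding cinner_same[symmetric] cinner_add_left cinner_add_right
    by (simp add: cinner_commute[of y x])
  also have "\<dots> = complex_of_real ((norm x)\<^sup>2 + 2 * Re (cinner x y) + (norm y)\<^sup>2)"
    unfolding cinner_same complex_add_cnj by simp
  finally show ?thesis by (simp only: of_real_eq_iff)
qed

lemma power2_norm_diff_cinner:
  "(norm (x - y))\<^sup>2 = (norm x)\<^sup>2 - 2 * Re (cinner x y) + (norm (y::'a::complex_inner))\<^sup>2"
  using power2_norm_add_cinner[of x "(-1) *\<^sub>R y"] cinner_scaleR_right[of x "-1" y] by simp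

lemma norm_scaleC: "norm (c *\<^sub>C x) = norm c * norm (x::'a::complex_inner)"
proof -
  have "complex_of_real ((norm (c *\<^sub>C x))\<^sup>2) = (c * cnj c) * cinner x x"
    unfolding cinner_same[symmetric] cinner_scaleC_left cinner_scaleC_right by simp
  also have "\<dots> = complex_of_real ((norm c * norm x)\<^sup>2)"
    by (simp add: cinner_same complex_norm_square[symmetric] power_mult_distrib)
  finally have "(norm (c *\<^sub>C x))\<^sup>2 = (norm c * norm x)\<^sup>2"
    by (simp only: of_real_eq_iff)
  then show ?thesis by (simp add: power2_eq_iff_nonneg)
qed

text \<open>
  The norm is subadditive by assumption, and expanding
  \<open>\<parallel>x + y\<parallel>\<^sup>2 \<le> (\<parallel>x\<parallel> + \<parallel>y\<parallel>)\<^sup>2\<close> gives the inequality for the real part; rotating \<open>x\<close> by a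
  unimodular factor then replaces the real part by the modulus.
\<close>
lemma cinner_Cauchy_Schwarz: "norm (cinner x y) \<le> norm x * norm (y::'a::complex_inner)"
proof -
  have re: "Re (cinner z y) \<le> norm z * norm y" for z
  proof -
    have "(norm (z + y))\<^sup>2 \<le> (norm z + norm y)\<^sup>2"
      by (intro power_mono norm_triangle_ineq) simp
    then show ?thesis
      by (simp add: power2_norm_add_cinner power2_sum)
  qed
  define p where "p = cinner x y"
  show ?thesis
  proof (cases "p = 0")
    case False
    have "cinner ((cnj p / norm p) *\<^sub>C x) y = complex_of_real (norm p)"
      using False complex_norm_square[of p]
      by (simp add: cinner_scaleC_left p_def[symmetric] field_simps power2_eq_square)
    then show ?thesis
      using re[of "(cnj p / norm p) *\<^sub>C x"] False by (simp add: norm_scaleC norm_divide p_def)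
  qed (simp add: p_def)
qed

lemma bounded_form_cinner: "bounded_form (cinner :: 'a::complex_inner \<Rightarrow> 'a \<Rightarrow> complex)"
  unfolding bounded_form_def
  using sesquilinear_cinner cinner_Cauchy_Schwarz by (metis mult_1)

lemma bounded_form_add:
  assumes "bounded_form a" and "bounded_form b"
  shows "bounded_form (\<lambda>u v. a u v + b u v)"
proof -
  obtain M where M: "\<And>u v. norm (a u v) \<le> M * norm u * norm v"
    using assms(1) unfolding bounded_form_def by blast
  obtain N where N: "\<And>u v. norm (b u v) \<le> N * norm u * norm v"
    using assms(2) unfolding bounded_form_def by blast
  have "norm (a u v + b u v) \<le> (M + N) * norm u * norm v" for u v
    using norm_triangle_ineq[of "a u v" "b u v"] M[of u v] N[of u v]
    by (simp add: algebra_simps)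
  moreover have "sesquilinear (\<lambda>u v. a u v + b u v)"
    using assms unfolding bounded_form_def sesquilinear_def by (simp add: algebra_simps)
  ultimately show ?thesis unfolding bounded_form_def by blast
qed

lemma bounded_form_cmult:
  assumes "bounded_form b"
  shows "bounded_form (\<lambda>u v. c * b u v)"
proof -
  obtain M where M: "\<And>u v. norm (b u v) \<le> M * norm u * norm v"
    using assms unfolding bounded_form_def by blast
  have "norm (c * b u v) \<le> (norm c * M) * norm u * norm v" for u v
    using mult_left_mono[OF M[of u v], of "norm c"] by (simp add: norm_mult mult.assoc)
  moreover have "sesquilinear (\<lambda>u v. c * b u v)"
    using assms unfolding bounded_form_def sesquilinear_def by (simp add: algebra_simps)
  ultimately show ?thesis unfolding bounded_form_def by blast
qed

lemma bounded_form_compose: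
  assumes "bounded_form b" and "bounded_clinear j"
  shows "bounded_form (\<lambda>u v. b (j u) (j v))"
proof -
  obtain M where "M > 0" and M: "\<And>u v. norm (b u v) \<le> M * norm u * norm v"
    using bounded_form_pos_bound[OF assms(1)] by blast
  have j: "bounded_linear j" and jc: "\<And>c u. j (c *\<^sub>C u) = c *\<^sub>C j u"
    using assms(2) by (auto simp: bounded_clinear_def)
  obtain K where "K \<ge> 0" and K: "\<And>u. norm (j u) \<le> norm u * K"
    using bounded_linear.nonneg_bounded[OF j] by blast
  have "norm (b (j u) (j v)) \<le> (M * K * K) * norm u * norm v" for u v
  proof -
    have "norm (j u) * norm (j v) \<le> (norm u * K) * (norm v * K)"
      using K \<open>K \<ge> 0\<close> by (intro mult_mono) auto
    then have "M * (norm (j u) * norm (j v)) \<le> M * ((norm u * K) * (norm v * K))"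
      using \<open>M > 0\<close> by simp
    also have "\<dots> = (M * K * K) * norm u * norm v"
      by (simp only: mult_ac)
    finally show ?thesis using M[of "j u" "j v"] by (simp add: mult.assoc)
  qed
  moreover have "sesquilinear (\<lambda>u v. b (j u) (j v))"
    using assms(1) jc linear_add[OF bounded_linear.linear[OF j]]
    unfolding bounded_form_def sesquilinear_def by simp
  ultimately show ?thesis unfolding bounded_form_def by blast
qed

text \<open>
  Continuity at the origin bounds the form on a small ball; homogeneity in each variable
  transports the bound to all vectors.
\<close>
lemma continuous_form_imp_bounded_form:
  assumes ses: "sesquilinear a" and cont: "continuous_form a"
  shows "bounded_form a"
proof -
  have zero_left: "a 0 v = 0" and zero_right: "a u 0 = 0" for u v
    using sesquilinear_scaleR_left[OF ses, of 0 0 v] sesquilinear_scaleR_right[OF ses, of u 0 0]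
    by simp_all
  from cont have "continuous_on UNIV (\<lambda>(u, v). a u v)" by (simp add: continuous_form_def)
  then obtain d where "d > 0" and d: "\<And>p. dist p (0, 0) < d \<Longrightarrow> norm (case p of (u, v) \<Rightarrow> a u v) < 1"
    unfolding continuous_on_iff using zero_left
    by (metis (no_types, lifting) UNIV_I case_prod_conv dist_0_norm dist_commute zero_less_one)
  define e where "e = d / 3"
  have "e > 0" using \<open>d > 0\<close> by (simp add: e_def)
  have small: "norm (a u v) \<le> 1" if "norm u = e" and "norm v = e" for u v
  proof -
    have "norm (u, v) \<le> norm u + norm v"
      by (rule norm_Pair_le)
    also have "\<dots> < d" using that \<open>d > 0\<close> by (simp add: e_def)
    finally have "dist (u, v) (0, 0) < d"
      by (simp add: dist_norm)
    from d[OF this] show ?thesis by simp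
  qed
  have "norm (a u v) \<le> (1 / e\<^sup>2) * norm u * norm v" for u v
  proof (cases "u = 0 \<or> v = 0")
    case False
    then have "norm ((e / norm u) *\<^sub>R u) = e" and "norm ((e / norm v) *\<^sub>R v) = e"
      using \<open>e > 0\<close> by auto
    from small[OF this] have "(e / norm u) * (e / norm v) * norm (a u v) \<le> 1"
      using False \<open>e > 0\<close>
      by (simp add: sesquilinear_scaleR_left[OF ses] sesquilinear_scaleR_right[OF ses] norm_mult
          norm_divide mult_ac)
    then show ?thesis using False \<open>e > 0\<close>
      by (simp add: field_simps power2_eq_square)
  qed (auto simp: zero_left zero_right)
  then show ?thesis using ses unfolding bounded_form_def by blast
qed

section \<open>The Riesz representation theorem and the Lax-Milgram lemma\<close>

text \<open>
  The first-order condition behind both variational arguments: a quadratic polynomial that is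
  minimal at zero has no linear term.
\<close>
lemma quadratic_nonneg_imp_linear_zero:
  fixes p q :: real
  assumes "\<And>t. 0 \<le> t * p + t\<^sup>2 * q"
  shows "p = 0"
proof (rule ccontr)
  assume "p \<noteq> 0"
  define s where "s = \<bar>q\<bar> + 1"
  then have "s > 0" and q: "\<bar>q\<bar> = s - 1" by auto
  define t where "t = - p / s"
  have "t * p + t\<^sup>2 * q \<le> t * p + t\<^sup>2 * \<bar>q\<bar>"
    by (intro add_left_mono mult_left_mono) auto
  also have "\<dots> = - (p\<^sup>2 / s\<^sup>2)"
    using \<open>s > 0\<close> by (simp add: q t_def field_simps power2_eq_square)
  also have "\<dots> < 0" using \<open>p \<noteq> 0\<close> \<open>s > 0\<close> by simp
  finally show False using assms[of t] by simp
qed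

text \<open>
  The representing vector minimises the energy \<open>\<parallel>u\<parallel>\<^sup>2 - 2 Re \<phi>(u)\<close>. The energy is bounded below,
  and by the parallelogram identity its minimising sequences are Cauchy.
\<close>
lemma Riesz_representation:
  fixes \<phi> :: "'a::chilbert_space \<Rightarrow> complex"
  assumes "bounded_antilinear \<phi>"
  obtains g where "\<And>v. \<phi> v = cinner g v"
proof -
  note add = bounded_antilinear_add[OF assms] and scale = bounded_antilinear_scaleR[OF assms]
  obtain C where "C > 0" and C: "\<And>x. norm (\<phi> x) \<le> C * norm x"
    using bounded_antilinear_pos_bound[OF assms] by blast
  define J where "J u = (norm u)\<^sup>2 - 2 * Re (\<phi> u)" for u
  have J_lower: "- C\<^sup>2 \<le> J u" for u
  proof -
    have "Re (\<phi> u) \<le> C * norm u"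
      using C[of u] complex_Re_le_cmod[of "\<phi> u"] by linarith
    moreover have "0 \<le> (norm u - C)\<^sup>2" by simp
    ultimately show ?thesis unfolding J_def power2_diff by (simp add: algebra_simps)
  qed
  define d where "d = (INF u. J u)"
  have bdd: "bdd_below (range J)" using J_lower by (intro bdd_belowI[where m = "- C\<^sup>2"]) auto
  have d_le: "d \<le> J u" for u unfolding d_def by (rule cINF_lower[OF bdd]) simp
  have "\<exists>u. J u < d + 1 / real (Suc n)" for n
    using cINF_less_iff[OF _ bdd, of "d + 1 / real (Suc n)"] by (simp add: d_def)
  then obtain x where x: "\<And>n. J (x n) < d + 1 / real (Suc n)" by metis
  have parallelogram: "(norm (u - v))\<^sup>2 = 2 * J u + 2 * J v - 4 * J ((1/2) *\<^sub>R (u + v))" for u v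
    unfolding J_def
    by (simp add: add scale power2_norm_diff_cinner power2_norm_add_cinner power_mult_distrib
        cinner_scaleR_left cinner_scaleR_right field_simps)
  have close: "(norm (x m - x n))\<^sup>2 < 4 / real (Suc k)" if "m \<ge> k" "n \<ge> k" for m n k
  proof -
    have "1 / real (Suc m) \<le> 1 / real (Suc k)" "1 / real (Suc n) \<le> 1 / real (Suc k)"
      using that by (auto simp: field_simps)
    with x[of m] x[of n] d_le[of "(1/2) *\<^sub>R (x m + x n)"] show ?thesis
      unfolding parallelogram by simp
  qed
  have "Cauchy x"
  proof (rule metric_CauchyI)
    fix e :: real assume "e > 0"
    then obtain k where k: "1 / real (Suc k) < e\<^sup>2 / 4"
      using nat_approx_posE[of "e\<^sup>2 / 4"] by auto
    have "dist (x m) (x n) < e" if "m \<ge> k" "n \<ge> k" for m n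
    proof -
      have "(norm (x m - x n))\<^sup>2 < e\<^sup>2"
        using close[OF that] k by simp
      then show ?thesis
        using power2_less_imp_less[of "norm (x m - x n)" e] \<open>e > 0\<close> by (simp add: dist_norm)
    qed
    then show "\<exists>M. \<forall>m\<ge>M. \<forall>n\<ge>M. dist (x m) (x n) < e" by blast
  qed
  then obtain g where g: "x \<longlonglongrightarrow> g"
    by (auto simp: Cauchy_convergent_iff convergent_def)
  have "bounded_linear \<phi>"
    by (rule bounded_linear_intro[where K = C])
      (use C in \<open>simp_all add: add scale scaleR_conv_of_real mult.commute\<close>)
  then have \<phi>_lim: "(\<lambda>n. \<phi> (x n)) \<longlonglongrightarrow> \<phi> g" using g by (rule bounded_linear.tendsto)
  have "(\<lambda>n. J (x n)) \<longlonglongrightarrow> J g"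
    unfolding J_def by (intro tendsto_intros g \<phi>_lim)
  moreover have "(\<lambda>n. d + 1 / real (Suc n)) \<longlonglongrightarrow> d"
    using tendsto_add[OF tendsto_const LIMSEQ_Suc[OF lim_1_over_n], of d] by simp
  ultimately have "J g \<le> d"
    by (rule LIMSEQ_le) (use x less_imp_le in blast)
  then have g_min: "J g \<le> J u" for u using d_le[of u] by simp
  have re: "Re (\<phi> v) = Re (cinner g v)" for v
  proof -
    have "0 \<le> t * (2 * (Re (cinner g v) - Re (\<phi> v))) + t\<^sup>2 * (norm v)\<^sup>2" for t
      using g_min[of "g + t *\<^sub>R v"]
      by (simp add: J_def add scale power2_norm_add_cinner cinner_scaleR_right power_mult_distrib
          algebra_simps)
    from quadratic_nonneg_imp_linear_zero[OF this] show ?thesis by simp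
  qed
  have "\<phi> v = cinner g v" for v
    using re[of v] re[of "\<i> *\<^sub>C v"]
    by (simp add: complex_eq_iff bounded_antilinear_scaleC[OF assms] cinner_scaleC_right)
  then show thesis by (rule that)
qed

text \<open>
  The Riesz theorem turns the equation into \<open>T u = g\<close>, that is, into a fixed point problem for
  \<open>u \<mapsto> u - \<rho>(T u - g)\<close>. Coercivity makes this map a contraction for small \<open>\<rho> > 0\<close>.
\<close>
lemma Lax_Milgram:
  fixes b :: "'a::chilbert_space \<Rightarrow> 'a \<Rightarrow> complex"
  assumes b: "bounded_form b" and "\<alpha> > 0" and coercive: "\<And>u. \<alpha> * (norm u)\<^sup>2 \<le> Re (b u u)"
    and \<phi>: "bounded_antilinear \<phi>"
  obtains u where "\<And>v. b u v = \<phi> v"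
proof -
  have ses: "sesquilinear b" using b by (simp add: bounded_form_def)
  obtain M0 where "M0 > 0" and M0: "\<And>u v. norm (b u v) \<le> M0 * norm u * norm v"
    using bounded_form_pos_bound[OF b] by blast
  \<comment> \<open>A bound that dominates \<open>\<alpha>\<close> keeps the squared contraction factor below nonnegative.\<close>
  define M where "M = max M0 \<alpha>"
  have "M > 0" "M \<ge> \<alpha>" "M \<ge> M0" using \<open>M0 > 0\<close> by (auto simp: M_def)
  have M: "norm (b u v) \<le> M * norm u * norm v" for u v
    using M0[of u v] mult_right_mono[OF \<open>M \<ge> M0\<close>, of "norm u * norm v"] by (simp add: mult.assoc)
  obtain g where g: "\<And>v. \<phi> v = cinner g v" using Riesz_representation[OF \<phi>] by blast
  have "\<exists>t. \<forall>v. b u v = cinner t v" for u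
    using Riesz_representation[OF bounded_form_antilinear[OF b, of u]] by metis
  then obtain T where T: "\<And>u v. b u v = cinner (T u) v" by metis
  have T_diff: "cinner (T x - T y) v = b (x - y) v" for x y v
    by (simp add: cinner_diff_left T[symmetric] sesquilinear_diff_left[OF ses])
  have T_lipschitz: "norm (T x - T y) \<le> M * norm (x - y)" for x y
  proof -
    have "complex_of_real ((norm (T x - T y))\<^sup>2) = b (x - y) (T x - T y)"
      by (simp only: cinner_same[symmetric] T_diff)
    then have "(norm (T x - T y))\<^sup>2 = norm (b (x - y) (T x - T y))"
      by (metis norm_of_real abs_power2)
    also have "\<dots> \<le> M * norm (x - y) * norm (T x - T y)" by (rule M)
    finally have "norm (T x - T y) * norm (T x - T y) \<le> (M * norm (x - y)) * norm (T x - T y)"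
      by (simp add: power2_eq_square)
    then show ?thesis
      using \<open>M > 0\<close> by (cases "T x = T y") auto
  qed
  \<comment> \<open>This \<open>\<rho>\<close> minimises the factor \<open>1 - 2\<rho>\<alpha> + \<rho>\<^sup>2M\<^sup>2\<close> that bounds the squared Lipschitz constant.\<close>
  define \<rho> where "\<rho> = \<alpha> / M\<^sup>2"
  define F where "F u = u - \<rho> *\<^sub>R (T u - g)" for u
  define q where "q = 1 - \<alpha>\<^sup>2 / M\<^sup>2"
  have "\<rho> > 0" using \<open>\<alpha> > 0\<close> \<open>M > 0\<close> by (simp add: \<rho>_def)
  have "\<alpha>\<^sup>2 \<le> M\<^sup>2" using \<open>M \<ge> \<alpha>\<close> \<open>\<alpha> > 0\<close> by (simp add: power_mono)
  then have "q \<ge> 0" "q < 1" using \<open>\<alpha> > 0\<close> \<open>M > 0\<close> by (auto simp: q_def field_simps)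
  have contraction: "dist (F x) (F y) \<le> sqrt q * dist x y" for x y
  proof -
    let ?d = "x - y" and ?D = "T x - T y"
    have "Re (cinner ?d ?D) = Re (b ?d ?d)"
      using T_diff[of x y ?d] cinner_commute[of ?d ?D] by (metis complex_cnj(1) complex_surj complex.sel(1))
    then have "(norm (?d - \<rho> *\<^sub>R ?D))\<^sup>2 = (norm ?d)\<^sup>2 - 2 * \<rho> * Re (b ?d ?d) + \<rho>\<^sup>2 * (norm ?D)\<^sup>2"
      by (simp add: power2_norm_diff_cinner[of ?d "\<rho> *\<^sub>R ?D"] cinner_scaleR_right power_mult_distrib)
    also have "\<dots> \<le> (norm ?d)\<^sup>2 - 2 * \<rho> * (\<alpha> * (norm ?d)\<^sup>2) + \<rho>\<^sup>2 * (M * norm ?d)\<^sup>2"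
      using coercive[of ?d] T_lipschitz[of x y] \<open>\<rho> > 0\<close>
      by (intro add_mono diff_mono mult_left_mono power_mono) auto
    also have "\<dots> = q * (norm ?d)\<^sup>2"
      using \<open>M > 0\<close> by (simp add: \<rho>_def q_def field_simps power2_eq_square)
    also have "\<dots> = (sqrt q * norm ?d)\<^sup>2"
      using \<open>q \<ge> 0\<close> by (simp add: power_mult_distrib)
    finally have "norm (?d - \<rho> *\<^sub>R ?D) \<le> sqrt q * norm ?d"
      by (rule power2_le_imp_le) (use \<open>q \<ge> 0\<close> in simp)
    moreover have "F x - F y = ?d - \<rho> *\<^sub>R ?D"
      by (simp add: F_def algebra_simps)
    ultimately show ?thesis by (simp add: dist_norm)
  qed
  have "\<exists>!u. F u = u"
    by (rule banach_fix_type[of "sqrt q"]) (use \<open>q \<ge> 0\<close> \<open>q < 1\<close> contraction in auto)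
  then obtain u where "F u = u" by blast
  then have "T u = g" using \<open>\<rho> > 0\<close> by (simp add: F_def)
  then have "b u v = \<phi> v" for v by (simp add: T g)
  then show thesis by (rule that)
qed

section \<open>Accretive compactly elliptic forms\<close>

text \<open>
  After passing to a subsequence along which the compact part converges, ellipticity applied to
  differences bounds \<open>\<mu>\<parallel>x\<^sub>m - x\<^sub>n\<parallel>\<^sup>2\<close> by quantities that tend to zero.
\<close>
lemma compactly_elliptic_approximate_solutions:
  fixes b :: "'a::chilbert_space \<Rightarrow> 'a \<Rightarrow> complex"
  assumes b: "bounded_form b" and ell: "compactly_elliptic TYPE('k::chilbert_space) b"
    and bdd: "\<And>n. norm (x n) \<le> K"
    and approx: "\<And>n v. norm (b (x n) v - \<phi> v) \<le> \<delta> n * norm v" and "\<delta> \<longlonglongrightarrow> 0"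
  obtains r w where "strict_mono (r :: nat \<Rightarrow> nat)" and "(x \<circ> r) \<longlonglongrightarrow> w" and "\<And>v. b w v = \<phi> v"
proof -
  have ses: "sesquilinear b" using b by (simp add: bounded_form_def)
  from ell obtain J :: "'a \<Rightarrow> 'k" and \<omega> \<mu> where "compact_operator J" and "\<mu> > 0"
    and coer: "\<And>u. \<mu> * (norm u)\<^sup>2 \<le> Re (b u u) + \<omega> * (norm (J u))\<^sup>2"
    unfolding compactly_elliptic_def by blast
  have "bounded (range x)" using bdd by (auto simp: bounded_iff)
  then have "compact (closure (J ` range x))"
    using \<open>compact_operator J\<close> by (simp add: compact_operator_def)
  then have "seq_compact (closure (J ` range x))"
    by (rule compact_imp_seq_compact)
  moreover have "J (x n) \<in> closure (J ` range x)" for n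
    using closure_subset[of "J ` range x"] by blast
  ultimately obtain l r where r: "strict_mono (r :: nat \<Rightarrow> nat)" and l: "((\<lambda>n. J (x n)) \<circ> r) \<longlonglongrightarrow> l"
    using seq_compactE[of _ "\<lambda>n. J (x n)"] by blast
  define y where "y = x \<circ> r"
  have J_cauchy: "Cauchy (\<lambda>n. J (y n))"
    using LIMSEQ_imp_Cauchy[OF l] by (simp add: y_def o_def)
  have \<delta>_lim: "(\<lambda>n. \<delta> (r n)) \<longlonglongrightarrow> 0"
    using LIMSEQ_subseq_LIMSEQ[OF \<open>\<delta> \<longlonglongrightarrow> 0\<close> r] by (simp add: o_def)
  have J_diff: "J (u - v) = J u - J v" for u v
    using \<open>compact_operator J\<close>
    by (simp add: compact_operator_def bounded_clinear_def linear_diff bounded_linear.linear)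
  have "K \<ge> 0" using bdd[of 0] norm_ge_zero order_trans by blast
  have y_bdd: "norm (y n) \<le> K" for n using bdd by (simp add: y_def)
  have estimate: "\<mu> * (norm (y m - y n))\<^sup>2
      \<le> (\<bar>\<delta> (r m)\<bar> + \<bar>\<delta> (r n)\<bar>) * (2 * K) + \<bar>\<omega>\<bar> * (norm (J (y m) - J (y n)))\<^sup>2" for m n
  proof -
    let ?d = "y m - y n"
    have split: "b ?d ?d = (b (y m) ?d - \<phi> ?d) - (b (y n) ?d - \<phi> ?d)"
      by (simp add: sesquilinear_diff_left[OF ses])
    have "Re (b ?d ?d) \<le> norm (b ?d ?d)" by (rule complex_Re_le_cmod)
    also have "\<dots> \<le> norm (b (y m) ?d - \<phi> ?d) + norm (b (y n) ?d - \<phi> ?d)"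
      unfolding split by (rule norm_triangle_ineq4)
    also have "\<dots> \<le> (\<delta> (r m) + \<delta> (r n)) * norm ?d"
      using approx[of "r m" ?d] approx[of "r n" ?d] by (simp add: y_def algebra_simps)
    also have "\<dots> \<le> (\<bar>\<delta> (r m)\<bar> + \<bar>\<delta> (r n)\<bar>) * (2 * K)"
      using norm_triangle_ineq4[of "y m" "y n"] y_bdd[of m] y_bdd[of n]
      by (intro mult_mono) auto
    finally have "Re (b ?d ?d) \<le> (\<bar>\<delta> (r m)\<bar> + \<bar>\<delta> (r n)\<bar>) * (2 * K)" .
    moreover have "\<omega> * (norm (J ?d))\<^sup>2 \<le> \<bar>\<omega>\<bar> * (norm (J ?d))\<^sup>2"
      by (intro mult_right_mono) auto
    ultimately show ?thesis using coer[of ?d] by (simp add: J_diff)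
  qed
  have "Cauchy y"
  proof (rule metric_CauchyI)
    fix e :: real assume "e > 0"
    define \<eta> where "\<eta> = \<mu> * e\<^sup>2 / (4 * K + \<bar>\<omega>\<bar> + 1)"
    have denom: "4 * K + \<bar>\<omega>\<bar> + 1 > 0" using \<open>K \<ge> 0\<close> by simp
    have "\<eta> > 0" using \<open>\<mu> > 0\<close> \<open>e > 0\<close> denom by (simp add: \<eta>_def)
    obtain N1 where N1: "\<And>n. n \<ge> N1 \<Longrightarrow> \<bar>\<delta> (r n)\<bar> < \<eta>"
      using LIMSEQ_D[OF \<delta>_lim \<open>\<eta> > 0\<close>] by auto
    obtain N2 where N2: "\<And>m n. m \<ge> N2 \<Longrightarrow> n \<ge> N2 \<Longrightarrow> norm (J (y m) - J (y n)) < sqrt \<eta>"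
      using CauchyD[OF J_cauchy, of "sqrt \<eta>"] \<open>\<eta> > 0\<close> by auto
    have "dist (y m) (y n) < e" if "m \<ge> max N1 N2" "n \<ge> max N1 N2" for m n
    proof -
      have J_small: "(norm (J (y m) - J (y n)))\<^sup>2 \<le> \<eta>"
        using power_mono[OF less_imp_le[OF N2[of m n]], of 2] that \<open>\<eta> > 0\<close> by simp
      have "\<mu> * (norm (y m - y n))\<^sup>2 \<le> (\<eta> + \<eta>) * (2 * K) + \<bar>\<omega>\<bar> * \<eta>"
        by (rule order_trans[OF estimate], intro add_mono mult_right_mono mult_left_mono)
          (use that N1[of m] N1[of n] J_small \<open>K \<ge> 0\<close> in auto)
      also have "\<dots> < (4 * K + \<bar>\<omega>\<bar> + 1) * \<eta>"
        using \<open>\<eta> > 0\<close> by (simp add: algebra_simps)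
      also have "\<dots> = \<mu> * e\<^sup>2"
        using denom by (simp add: \<eta>_def)
      finally have "(norm (y m - y n))\<^sup>2 < e\<^sup>2" using \<open>\<mu> > 0\<close> by simp
      then show ?thesis
        using power2_less_imp_less[of "norm (y m - y n)" e] \<open>e > 0\<close> by (simp add: dist_norm)
    qed
    then show "\<exists>N. \<forall>m\<ge>N. \<forall>n\<ge>N. dist (y m) (y n) < e" by blast
  qed
  then obtain w where w: "y \<longlonglongrightarrow> w"
    by (auto simp: Cauchy_convergent_iff convergent_def)
  obtain M where "M > 0" and M: "\<And>u v. norm (b u v) \<le> M * norm u * norm v"
    using bounded_form_pos_bound[OF b] by blast
  have "b w v = \<phi> v" for v
  proof -
    have "bounded_linear (\<lambda>u. b u v)"
      by (rule bounded_linear_intro[where K = "M * norm v"])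
        (use M[of _ v] in \<open>simp_all add: sesquilinear_add_left[OF ses] sesquilinear_scaleR_left[OF ses]
          scaleR_conv_of_real mult_ac\<close>)
    then have "(\<lambda>n. b (y n) v) \<longlonglongrightarrow> b w v" using w by (rule bounded_linear.tendsto)
    moreover have "(\<lambda>n. b (y n) v - \<phi> v) \<longlonglongrightarrow> 0"
    proof (rule Lim_null_comparison)
      show "\<forall>\<^sub>F n in sequentially. norm (b (y n) v - \<phi> v) \<le> \<delta> (r n) * norm v"
        using approx by (simp add: y_def)
      show "(\<lambda>n. \<delta> (r n) * norm v) \<longlonglongrightarrow> 0"
        using tendsto_mult_right[OF \<delta>_lim, of "norm v"] by simp
    qed
    then have "(\<lambda>n. b (y n) v) \<longlonglongrightarrow> \<phi> v" by (simp add: Lim_null[symmetric])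
    ultimately show ?thesis by (rule LIMSEQ_unique)
  qed
  with r w show thesis unfolding y_def by (intro that)
qed

text \<open>
  A left kernel vector \<open>w\<close> is a minimum point of the nonnegative function \<open>u \<mapsto> Re b(u, u)\<close>, and the
  first-order condition there says \<open>Re b(v, w) = 0\<close>.
\<close>
lemma accretive_form_kernel_symmetric:
  assumes ses: "sesquilinear b" and acc: "accretive_form b" and ker: "\<And>v. b w v = 0"
  shows "b v w = 0"
proof -
  have re: "Re (b v w) = 0" for v
  proof -
    have "0 \<le> t * Re (b v w) + t\<^sup>2 * Re (b v v)" for t
    proof -
      have "b (w + t *\<^sub>R v) (w + t *\<^sub>R v) = t * b v w + t\<^sup>2 * b v v"
        using sesquilinear_scaleR_left[OF ses] sesquilinear_scaleR_right[OF ses]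
        by (simp add: sesquilinear_add_left[OF ses] sesquilinear_add_right[OF ses] ker
            power2_eq_square)
      moreover have "0 \<le> Re (b (w + t *\<^sub>R v) (w + t *\<^sub>R v))"
        using acc by (simp add: accretive_form_def)
      ultimately show ?thesis by (simp flip: of_real_power)
    qed
    then show ?thesis by (rule quadratic_nonneg_imp_linear_zero)
  qed
  show ?thesis
    using re[of v] re[of "\<i> *\<^sub>C v"] by (simp add: complex_eq_iff sesquilinear_scaleC_left[OF ses])
qed

text \<open>
  The equation is perturbed by \<open>\<epsilon>(\<cdot>, \<cdot>)\<close>; testing the perturbed equation with a kernel vector shows
  that its solutions are orthogonal to the kernel, which prevents them from blowing up.
\<close>
lemma accretive_compactly_elliptic_solvable:
  fixes b :: "'a::chilbert_space \<Rightarrow> 'a \<Rightarrow> complex"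
  assumes b: "bounded_form b" and acc: "accretive_form b"
    and ell: "compactly_elliptic TYPE('k::chilbert_space) b"
    and \<phi>: "bounded_antilinear \<phi>" and \<phi>_ker: "\<And>w. (\<And>v. b w v = 0) \<Longrightarrow> \<phi> w = 0"
  obtains u where "\<And>v. b u v = \<phi> v"
proof -
  have ses: "sesquilinear b" using b by (simp add: bounded_form_def)
  define \<epsilon> :: "nat \<Rightarrow> real" where "\<epsilon> n = 1 / real (Suc n)" for n
  have \<epsilon>_pos: "\<epsilon> n > 0" for n by (simp add: \<epsilon>_def)
  have \<epsilon>_lim: "\<epsilon> \<longlonglongrightarrow> 0" unfolding \<epsilon>_def using LIMSEQ_Suc[OF lim_1_over_n] by simp
  have "\<exists>u. \<forall>v. b u v + \<epsilon> n * cinner u v = \<phi> v" for n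
  proof -
    have form: "bounded_form (\<lambda>u v. b u v + complex_of_real (\<epsilon> n) * cinner u v)"
      by (intro bounded_form_add b bounded_form_cmult bounded_form_cinner)
    have "\<epsilon> n * (norm u)\<^sup>2 \<le> Re (b u u + complex_of_real (\<epsilon> n) * cinner u u)" for u
      using acc by (simp add: accretive_form_def cinner_same flip: of_real_power)
    from Lax_Milgram[OF form \<epsilon>_pos this \<phi>] show ?thesis by metis
  qed
  then obtain u where u: "\<And>n v. b (u n) v + \<epsilon> n * cinner (u n) v = \<phi> v" by metis
  obtain C where "C > 0" and C: "\<And>x. norm (\<phi> x) \<le> C * norm x"
    using bounded_antilinear_pos_bound[OF \<phi>] by blast
  have perturbation: "norm (\<epsilon> n * cinner x v) \<le> (\<epsilon> n * K) * norm v" if "norm x \<le> K" for n x v K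
  proof -
    have "norm (cinner x v) \<le> K * norm v"
      using cinner_Cauchy_Schwarz[of x v] mult_right_mono[OF that, of "norm v"] by simp
    from mult_left_mono[OF this, of "\<epsilon> n"] \<epsilon>_pos[of n] show ?thesis
      by (simp add: norm_mult mult.assoc)
  qed
  have "\<exists>K. \<forall>k. \<exists>n\<ge>k. norm (u n) \<le> K"
  proof (rule ccontr)
    assume "\<nexists>K. \<forall>k. \<exists>n\<ge>k. norm (u n) \<le> K"
    then have blowup: "\<exists>k. \<forall>n\<ge>k. norm (u n) > K" for K by (meson not_le)
    then have "filterlim (\<lambda>n. norm (u n)) at_top sequentially"
      unfolding filterlim_at_top_dense eventually_sequentially by blast
    then have "(\<lambda>n. C / norm (u n)) \<longlonglongrightarrow> 0"
      by (intro tendsto_divide_0[OF tendsto_const] filterlim_at_top_imp_at_infinity)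
    then have \<delta>_lim: "(\<lambda>n. C / norm (u n) + \<epsilon> n * 1) \<longlonglongrightarrow> 0"
      using tendsto_add[OF _ \<epsilon>_lim] by fastforce
    \<comment> \<open>If \<open>u n = 0\<close>, then \<open>x n = 0\<close>, and the estimates below persist because \<open>1 / 0 = 0\<close>.\<close>
    define x where "x n = (1 / norm (u n)) *\<^sub>R u n" for n
    have x_bdd: "norm (x n) \<le> 1" for n by (simp add: x_def)
    have almost_kernel: "norm (b (x n) v - 0) \<le> (C / norm (u n) + \<epsilon> n * 1) * norm v" for n v
    proof -
      have "b (x n) v = (1 / norm (u n)) * (\<phi> v - \<epsilon> n * cinner (u n) v)"
        using u[of n v] by (simp add: x_def sesquilinear_scaleR_left[OF ses] flip: u[of n v])
      also have "\<dots> = (1 / norm (u n)) * \<phi> v - \<epsilon> n * cinner (x n) v"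
        by (simp add: x_def cinner_scaleR_left diff_divide_distrib)
      finally have "norm (b (x n) v) \<le> norm ((1 / norm (u n)) * \<phi> v) + norm (\<epsilon> n * cinner (x n) v)"
        by (simp add: norm_triangle_ineq4)
      moreover have "norm ((1 / norm (u n)) * \<phi> v) \<le> C / norm (u n) * norm v"
        using mult_left_mono[OF C[of v], of "1 / norm (u n)"] by (simp add: norm_mult norm_divide)
      ultimately show ?thesis
        using perturbation[OF x_bdd, of n n v] by (simp add: distrib_right)
    qed
    obtain r w where r: "strict_mono (r :: nat \<Rightarrow> nat)" and w: "(x \<circ> r) \<longlonglongrightarrow> w"
      and ker: "\<And>v. b w v = 0"
      by (rule compactly_elliptic_approximate_solutions[OF b ell x_bdd almost_kernel \<delta>_lim])
        (rule that)
    have orth: "cinner (x n) w = 0" for n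
    proof -
      have "complex_of_real (\<epsilon> n) * cinner (u n) w = 0"
        using u[of n w] accretive_form_kernel_symmetric[OF ses acc ker] \<phi>_ker[OF ker] by simp
      then show ?thesis using \<epsilon>_pos[of n] by (simp add: x_def cinner_scaleR_left)
    qed
    \<comment> \<open>By Pythagoras those \<open>x n\<close> that have norm one keep distance at least one from \<open>w\<close>.\<close>
    have "(\<lambda>n. norm (x (r n) - w)) \<longlonglongrightarrow> 0"
      using w by (simp add: o_def tendsto_norm_zero Lim_null[symmetric])
    then obtain N1 where N1: "\<And>n. n \<ge> N1 \<Longrightarrow> norm (x (r n) - w) < 1"
      using LIMSEQ_D[of _ 0 1] by fastforce
    obtain N2 where N2: "\<And>n. n \<ge> N2 \<Longrightarrow> norm (u n) > 0" using blowup by blast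
    define n where "n = max N1 N2"
    have "norm (u (r n)) > 0"
      using seq_suble[OF r, of n] by (intro N2) (simp add: n_def)
    then have "norm (x (r n)) = 1" by (simp add: x_def)
    then have "1 \<le> (norm (x (r n) - w))\<^sup>2"
      by (simp add: power2_norm_diff_cinner orth)
    moreover have "(norm (x (r n) - w))\<^sup>2 < 1"
      using N1[of n] by (simp add: n_def abs_square_less_1)
    ultimately show False by simp
  qed
  \<comment> \<open>The indices \<open>s k\<close> need not increase; \<open>k \<le> s k\<close> suffices, as \<open>\<epsilon>\<close> is decreasing.\<close>
  then obtain K s where s: "\<And>k. s k \<ge> k" and K: "\<And>k. norm (u (s k)) \<le> K" by metis
  have approx: "norm (b (u (s k)) v - \<phi> v) \<le> (\<epsilon> k * K) * norm v" for k v
  proof -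
    have "b (u (s k)) v - \<phi> v = - (\<epsilon> (s k) * cinner (u (s k)) v)"
      by (simp flip: u[of "s k" v])
    then have "norm (b (u (s k)) v - \<phi> v) \<le> (\<epsilon> (s k) * K) * norm v"
      using perturbation[OF K, of "s k" k v] by simp
    also have "\<dots> \<le> (\<epsilon> k * K) * norm v"
    proof -
      have "\<epsilon> (s k) \<le> \<epsilon> k" using s[of k] by (simp add: \<epsilon>_def field_simps)
      moreover have "K \<ge> 0" using K[of 0] norm_ge_zero order_trans by blast
      ultimately show ?thesis by (intro mult_right_mono) auto
    qed
    finally show ?thesis .
  qed
  have "(\<lambda>k. \<epsilon> k * K) \<longlonglongrightarrow> 0" using tendsto_mult_left_zero[OF \<epsilon>_lim] .
  then show thesis
    by (rule compactly_elliptic_approximate_solutions[OF b ell K approx]) (rule that)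
qed

section \<open>The associated graph\<close>

lemma linear_associated_graph:
  assumes "sesquilinear a" and "bounded_clinear j"
  shows "linear_graph (associated_graph a j)"
proof -
  have j_add: "j (u + v) = j u + j v" and j_scale: "j (c *\<^sub>C u) = c *\<^sub>C j u" and j0: "j 0 = 0" for u v c
    using assms(2) unfolding bounded_clinear_def
    by (auto simp: linear_add linear_0 bounded_linear.linear)
  have zero: "a 0 v = 0" "cinner 0 (j v) = 0" for v
    using sesquilinear_scaleR_left[OF assms(1), of 0 0 v] cinner_scaleR_left[of 0 0 "j v"] by auto
  show ?thesis
    unfolding linear_graph_def associated_graph_def
  proof (intro conjI allI impI; clarsimp)
    show "\<exists>u. j u = 0 \<and> (\<forall>v. a u v = cinner 0 (j v))"
      using j0 zero by (intro exI[of _ 0]) simp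
  next
    fix y y' u u'
    assume "\<forall>v. a u v = cinner y (j v)" "\<forall>v. a u' v = cinner y' (j v)"
    then show "\<exists>w. j w = j u + j u' \<and> (\<forall>v. a w v = cinner (y + y') (j v))"
      by (intro exI[of _ "u + u'"]) (simp add: j_add sesquilinear_add_left[OF assms(1)] cinner_add_left)
  next
    fix c y u
    assume "\<forall>v. a u v = cinner y (j v)"
    then show "\<exists>w. j w = c *\<^sub>C j u \<and> (\<forall>v. a w v = cinner (c *\<^sub>C y) (j v))"
      by (intro exI[of _ "c *\<^sub>C u"])
        (simp add: j_scale sesquilinear_scaleC_left[OF assms(1)] cinner_scaleC_left)
  qed
qed

lemma accretive_associated_graph:
  assumes "sesquilinear a" and "accretive_form a" and "bounded_clinear j"
  shows "accretive_graph (associated_graph a j)"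
proof -
  have "Re (cinner (j u) y) \<ge> 0" if "\<forall>v. a u v = cinner y (j v)" for u y
  proof -
    have "cinner (j u) y = cnj (a u u)" using that cinner_commute by metis
    then show ?thesis using assms(2) by (simp add: accretive_form_def)
  qed
  then show ?thesis
    using linear_associated_graph[OF assms(1,3)]
    by (auto simp: accretive_graph_def associated_graph_def)
qed

theorem theorem8p1:
  fixes a :: "'v::chilbert_space \<Rightarrow> 'v \<Rightarrow> complex"
    and j :: "'v \<Rightarrow> 'h::chilbert_space"
  assumes "sesquilinear a" and "continuous_form a" and "accretive_form a"
    and "bounded_clinear j"
    and "compactly_elliptic TYPE('k::chilbert_space) a"
  shows "m_accretive (associated_graph a j)"
proof -
  define b where "b u v = a u v + cinner (j u) (j v)" for u v
  have j_form: "bounded_form (\<lambda>u v. cinner (j u) (j v))"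
    by (rule bounded_form_compose[OF bounded_form_cinner assms(4)])
  have b: "bounded_form b"
    unfolding b_def
    by (intro bounded_form_add j_form continuous_form_imp_bounded_form assms(1,2))
  have re_b: "Re (b u u) = Re (a u u) + (norm (j u))\<^sup>2" for u
    by (simp add: b_def cinner_same flip: of_real_power)
  have a_nonneg: "Re (a u u) \<ge> 0" for u using assms(3) by (simp add: accretive_form_def)
  have acc: "accretive_form b" using a_nonneg by (simp add: accretive_form_def re_b)
  have ell: "compactly_elliptic TYPE('k) b"
  proof -
    from assms(5) obtain J :: "'v \<Rightarrow> 'k" and \<omega> \<mu> where "compact_operator J" "\<mu> > 0"
      and coer: "\<And>u. Re (a u u) + \<omega> * (norm (J u))\<^sup>2 \<ge> \<mu> * (norm u)\<^sup>2"
      unfolding compactly_elliptic_def by blast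
    moreover have "Re (b u u) + \<omega> * (norm (J u))\<^sup>2 \<ge> \<mu> * (norm u)\<^sup>2" for u
      using coer[of u] zero_le_power2[of "norm (j u)"] unfolding re_b by linarith
    ultimately show ?thesis unfolding compactly_elliptic_def by blast
  qed
  have "\<exists>x y. f = y + x \<and> (x, y) \<in> associated_graph a j" for f
  proof -
    have j: "bounded_linear j" "\<And>c u. j (c *\<^sub>C u) = c *\<^sub>C j u"
      using assms(4) by (auto simp: bounded_clinear_def)
    have \<phi>: "bounded_antilinear (\<lambda>v. cinner f (j v))"
    proof -
      obtain B where B: "\<And>v. norm (j v) \<le> norm v * B"
        using bounded_linear.bounded[OF j(1)] by blast
      have "norm (cinner f (j v)) \<le> (norm f * B) * norm v" for v
        using cinner_Cauchy_Schwarz[of f "j v"] mult_left_mono[OF B[of v], of "norm f"]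
        by (simp add: mult_ac)
      then show ?thesis
        using j(2) linear_add[OF bounded_linear.linear[OF j(1)]]
        unfolding bounded_antilinear_def
        by (auto simp: cinner_add_right cinner_scaleC_right)
    qed
    have \<phi>_ker: "cinner f (j w) = 0" if "\<And>v. b w v = 0" for w
    proof -
      have "(norm (j w))\<^sup>2 \<le> 0" using re_b[of w] a_nonneg[of w] unfolding that[of w] zero_complex.sel by linarith
      then show ?thesis using cinner_Cauchy_Schwarz[of f "j w"] by simp
    qed
    obtain u where u: "\<And>v. b u v = cinner f (j v)"
      using accretive_compactly_elliptic_solvable[OF b acc ell \<phi> \<phi>_ker] by blast
    have "a u v = cinner (f - j u) (j v)" for v
      using u[of v] by (simp add: b_def cinner_diff_left eq_diff_eq)
    then have "(j u, f - j u) \<in> associated_graph a j"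
      by (auto simp: associated_graph_def)
    then show ?thesis by (intro exI[of _ "j u"] exI[of _ "f - j u"]) simp
  qed
  then show ?thesis
    using accretive_associated_graph[OF assms(1,3,4)] unfolding m_accretive_def by auto
qed

end
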